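(* Let $R$ be a ring with unity, let $\mathcal{X}$ be a semibrick of left $R$-modules, let $N$ be a module with an $\mathcal{X}$-filtration, and let $M$ be an $\mathcal{X}$-semisimple module. For any homomorphism $f\in\mathrm{Hom}(N,M)$, the image of $f$ is an $\mathcal{X}$-semisimple submodule and a direct summand of $M$.
   Context: A brick is a finitely presented left $R$-module whose endomorphism ring is a division ring. A semibrick is a class $\mathcal{X}$ of pairwise non-isomorphic bricks with $\mathrm{Hom}(X,X')=0$ for distinct $X,X'\in\mathcal{X}$. A filtration of a module $N$ is an ascending chain $(N_\lambda,\lambda\le\mu)$ of submodules ($\mu$ an ordinal) with $N_0=0$, $N_\mu=N$ and $N_\nu=\bigcup_{\lambda<\nu}N_\lambda$ for limit ordinals $\nu\le\mu$. It is an $\mathcal{X}$-filtration if each $N_{\lambda+1}/N_\lambda$ ($\lambda<\mu$) is isomorphic to a module in $\mathcal{X}$. A module is $\mathcal{X}$-semisimple if it is isomorphic to a (possibly empty or infinite) direct sum of objects from $\mathcal{X}$ (repetitions allowed). *)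

theory Defs
  imports "HOL-Algebra.AbelCoset" "HOL-Algebra.Module"
begin

section \<open>Left modules over a ring that need not be commutative\<close>

text \<open>
  The locale \<open>module\<close> of HOL-Algebra assumes a commutative ring of scalars.  The
  record type \<open>module\<close> and the locale \<open>submodule\<close> make no such assumption and are
  reused.  The fields \<open>mult\<close> and \<open>one\<close> that the record inherits from \<open>ring\<close> play
  no role.
\<close>

locale left_module = R?: ring R + M?: abelian_group M
  for R :: "('a, 'r) ring_scheme" (structure) and M :: "('a, 'b) module" (structure) +
  assumes smult_closed [simp, intro]:
      "\<lbrakk>a \<in> carrier R; x \<in> carrier M\<rbrakk> \<Longrightarrow> a \<odot>\<^bsub>M\<^esub> x \<in> carrier M"
    and smult_l_distr:
      "\<lbrakk>a \<in> carrier R; b \<in> carrier R; x \<in> carrier M\<rbrakk> \<Longrightarrow>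
        (a \<oplus> b) \<odot>\<^bsub>M\<^esub> x = a \<odot>\<^bsub>M\<^esub> x \<oplus>\<^bsub>M\<^esub> b \<odot>\<^bsub>M\<^esub> x"
    and smult_r_distr:
      "\<lbrakk>a \<in> carrier R; x \<in> carrier M; y \<in> carrier M\<rbrakk> \<Longrightarrow>
        a \<odot>\<^bsub>M\<^esub> (x \<oplus>\<^bsub>M\<^esub> y) = a \<odot>\<^bsub>M\<^esub> x \<oplus>\<^bsub>M\<^esub> a \<odot>\<^bsub>M\<^esub> y"
    and smult_assoc1:
      "\<lbrakk>a \<in> carrier R; b \<in> carrier R; x \<in> carrier M\<rbrakk> \<Longrightarrow>
        (a \<otimes> b) \<odot>\<^bsub>M\<^esub> x = a \<odot>\<^bsub>M\<^esub> (b \<odot>\<^bsub>M\<^esub> x)"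
    and smult_one [simp]:
      "x \<in> carrier M \<Longrightarrow> \<one> \<odot>\<^bsub>M\<^esub> x = x"

definition mod_hom ::
  "('a, 'r) ring_scheme \<Rightarrow> ('a, 'b) module \<Rightarrow> ('a, 'c) module \<Rightarrow> ('b \<Rightarrow> 'c) set" where
  "mod_hom R M N = {f \<in> hom (add_monoid M) (add_monoid N).
     \<forall>a \<in> carrier R. \<forall>x \<in> carrier M. f (a \<odot>\<^bsub>M\<^esub> x) = a \<odot>\<^bsub>N\<^esub> f x}"

definition mod_iso ::
  "('a, 'r) ring_scheme \<Rightarrow> ('a, 'b) module \<Rightarrow> ('a, 'c) module \<Rightarrow> bool" where
  "mod_iso R M N \<longleftrightarrow> (\<exists>f \<in> mod_hom R M N. bij_betw f (carrier M) (carrier N))"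

definition direct_sum :: "'i set \<Rightarrow> ('i \<Rightarrow> ('a, 'b) module) \<Rightarrow> ('a, 'i \<Rightarrow> 'b) module" where
  "direct_sum I Y =
    \<lparr>carrier = {x \<in> (\<Pi>\<^sub>E i\<in>I. carrier (Y i)). finite {i \<in> I. x i \<noteq> \<zero>\<^bsub>Y i\<^esub>}},
     monoid.mult = undefined, one = undefined,
     zero = (\<lambda>i\<in>I. \<zero>\<^bsub>Y i\<^esub>),
     add = (\<lambda>x y. \<lambda>i\<in>I. x i \<oplus>\<^bsub>Y i\<^esub> y i),
     smult = (\<lambda>a x. \<lambda>i\<in>I. a \<odot>\<^bsub>Y i\<^esub> x i)\<rparr>"

definition regular_module :: "('a, 'r) ring_scheme \<Rightarrow> ('a, 'a) module" where
  "regular_module R =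
    \<lparr>carrier = carrier R, monoid.mult = undefined, one = undefined,
     zero = \<zero>\<^bsub>R\<^esub>, add = add R, smult = monoid.mult R\<rparr>"

definition free_module :: "('a, 'r) ring_scheme \<Rightarrow> nat \<Rightarrow> ('a, nat \<Rightarrow> 'a) module" where
  "free_module R n = direct_sum {..<n} (\<lambda>_. regular_module R)"

definition quotient_module :: "('a, 'b) module \<Rightarrow> 'b set \<Rightarrow> ('a, 'b set) module" where
  "quotient_module M K =
    \<lparr>carrier = a_rcosets\<^bsub>M\<^esub> K, monoid.mult = undefined, one = undefined,
     zero = K, add = set_add M,
     smult = (\<lambda>a A. \<Union>x\<in>A. K +>\<^bsub>M\<^esub> (a \<odot>\<^bsub>M\<^esub> x))\<rparr>"

text \<open>\<open>H\<close> is a direct summand of \<open>M\<close>: it has a complementary submodule \<open>C\<close>.\<close>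

definition direct_summand ::
  "('a, 'r) ring_scheme \<Rightarrow> ('a, 'b) module \<Rightarrow> 'b set \<Rightarrow> bool" where
  "direct_summand R M H \<longleftrightarrow> submodule H R M \<and>
     (\<exists>C. submodule C R M \<and> H <+>\<^bsub>M\<^esub> C = carrier M \<and> H \<inter> C = {\<zero>\<^bsub>M\<^esub>})"


section \<open>Semibricks\<close>

text \<open>
  Endomorphisms are represented by functions that are \<open>extensional\<close> on the carrier,
  so that equality in the endomorphism ring is equality of maps on the carrier.
\<close>

definition end_ring :: "('a, 'r) ring_scheme \<Rightarrow> ('a, 'b) module \<Rightarrow> ('b \<Rightarrow> 'b) ring" where
  "end_ring R M =
    \<lparr>carrier = mod_hom R M M \<inter> extensional (carrier M),
     monoid.mult = compose (carrier M),
     one = (\<lambda>x\<in>carrier M. x),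
     zero = (\<lambda>x\<in>carrier M. \<zero>\<^bsub>M\<^esub>),
     add = (\<lambda>f g. \<lambda>x\<in>carrier M. f x \<oplus>\<^bsub>M\<^esub> g x)\<rparr>"

definition is_division_ring :: "('a, 'r) ring_scheme \<Rightarrow> bool" where
  "is_division_ring D \<longleftrightarrow>
     ring D \<and> \<one>\<^bsub>D\<^esub> \<noteq> \<zero>\<^bsub>D\<^esub> \<and> Units D = carrier D - {\<zero>\<^bsub>D\<^esub>}"

text \<open>Finite presentation: an exact sequence \<open>R\<^sup>m \<rightarrow> R\<^sup>n \<rightarrow> M \<rightarrow> 0\<close>.\<close>

definition finitely_presented :: "('a, 'r) ring_scheme \<Rightarrow> ('a, 'b) module \<Rightarrow> bool" where
  "finitely_presented R M \<longleftrightarrow>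
     (\<exists>m n. \<exists>g \<in> mod_hom R (free_module R m) (free_module R n).
            \<exists>p \<in> mod_hom R (free_module R n) M.
        g ` carrier (free_module R m) = a_kernel (free_module R n) M p \<and>
        p ` carrier (free_module R n) = carrier M)"

definition brick :: "('a, 'r) ring_scheme \<Rightarrow> ('a, 'b) module \<Rightarrow> bool" where
  "brick R M \<longleftrightarrow>
     left_module R M \<and> finitely_presented R M \<and> is_division_ring (end_ring R M)"

definition semibrick :: "('a, 'r) ring_scheme \<Rightarrow> ('a, 'b) module set \<Rightarrow> bool" where
  "semibrick R \<X> \<longleftrightarrow>
     (\<forall>X \<in> \<X>. brick R X) \<and>
     (\<forall>X \<in> \<X>. \<forall>X' \<in> \<X>. X \<noteq> X' \<longrightarrow>
        \<not> mod_iso R X X' \<and> (\<forall>f \<in> mod_hom R X X'. \<forall>x \<in> carrier X. f x = \<zero>\<^bsub>X'\<^esub>))"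


section \<open>Filtrations\<close>

text \<open>
  The elements of a well-ordered type serve as ordinals.  A limit ordinal is
  neither zero nor a successor.
\<close>

definition ord_zero :: "'i::wellorder" where
  "ord_zero = (LEAST \<alpha>. True)"

definition ord_succ :: "'i::wellorder \<Rightarrow> 'i" where
  "ord_succ \<alpha> = (LEAST \<nu>. \<alpha> < \<nu>)"

definition ord_limit :: "'i::wellorder \<Rightarrow> bool" where
  "ord_limit \<nu> \<longleftrightarrow> \<nu> \<noteq> ord_zero \<and> (\<nexists>\<alpha>. \<alpha> < \<nu> \<and> \<nu> = ord_succ \<alpha>)"

definition filtration ::
  "('a, 'r) ring_scheme \<Rightarrow> ('a, 'c) module \<Rightarrow> ('i::wellorder \<Rightarrow> 'c set) \<Rightarrow> 'i \<Rightarrow> bool" where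
  "filtration R N F \<mu> \<longleftrightarrow>
     (\<forall>\<alpha>\<le>\<mu>. submodule (F \<alpha>) R N) \<and>
     (\<forall>\<alpha>\<le>\<mu>. \<forall>\<beta>\<le>\<alpha>. F \<beta> \<subseteq> F \<alpha>) \<and>
     F ord_zero = {\<zero>\<^bsub>N\<^esub>} \<and>
     F \<mu> = carrier N \<and>
     (\<forall>\<nu>\<le>\<mu>. ord_limit \<nu> \<longrightarrow> F \<nu> = (\<Union>\<alpha>\<in>{..<\<nu>}. F \<alpha>))"

definition X_filtration ::
  "('a, 'r) ring_scheme \<Rightarrow> ('a, 'b) module set \<Rightarrow> ('a, 'c) module \<Rightarrow>
   ('i::wellorder \<Rightarrow> 'c set) \<Rightarrow> 'i \<Rightarrow> bool" where
  "X_filtration R \<X> N F \<mu> \<longleftrightarrow> filtration R N F \<mu> \<and>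
     (\<forall>\<alpha><\<mu>. \<exists>X \<in> \<X>.
        mod_iso R (quotient_module (N\<lparr>carrier := F (ord_succ \<alpha>)\<rparr>) (F \<alpha>)) X)"


section \<open>Semisimple modules relative to a class of modules\<close>

text \<open>
  The index set is taken inside the type of elements of \<open>M\<close>.  This loses nothing,
  since a direct sum of nonzero modules has at least as many elements as summands;
  see \<open>X_semisimpleI\<close> below for index sets of an arbitrary type.
\<close>

definition X_semisimple ::
  "('a, 'r) ring_scheme \<Rightarrow> ('a, 'b) module set \<Rightarrow> ('a, 'd) module \<Rightarrow> bool" where
  "X_semisimple R \<X> M \<longleftrightarrow>
     (\<exists>(I :: 'd set) Y. (\<forall>i \<in> I. Y i \<in> \<X>) \<and> mod_iso R M (direct_sum I Y))"

lemma X_semisimpleI: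
  fixes I :: "'i set" and M :: "('a, 'd) module" and Y :: "'i \<Rightarrow> ('a, 'b) module"
  assumes Y: "\<And>i. i \<in> I \<Longrightarrow> Y i \<in> \<X>" "\<And>i. i \<in> I \<Longrightarrow> left_module R (Y i)"
    and iso: "mod_iso R M (direct_sum I Y)"
  shows "X_semisimple R \<X> M"
proof -
  let ?S = "direct_sum I Y"
  have ag: "abelian_group (Y i)" if "i \<in> I" for i
    using Y(2)[OF that] by (simp add: left_module_def)
  have z: "\<zero>\<^bsub>Y i\<^esub> \<in> carrier (Y i)" if "i \<in> I" for i
    using ag[OF that] by (simp add: abelian_group.axioms(1) abelian_monoid.zero_closed)
  obtain \<phi> where \<phi>: "\<phi> \<in> mod_hom R M ?S" and bij: "bij_betw \<phi> (carrier M) (carrier ?S)"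
    using iso by (auto simp: mod_iso_def)
  define J where "J = {i \<in> I. carrier (Y i) \<noteq> {\<zero>\<^bsub>Y i\<^esub>}}"
  have JI: "J \<subseteq> I" by (auto simp: J_def)
  have "\<forall>j\<in>J. \<exists>y. y \<in> carrier (Y j) \<and> y \<noteq> \<zero>\<^bsub>Y j\<^esub>"
    using z by (fastforce simp: J_def)
  then obtain y where y: "\<And>j. j \<in> J \<Longrightarrow> y j \<in> carrier (Y j) \<and> y j \<noteq> \<zero>\<^bsub>Y j\<^esub>"
    by metis
  define e where "e j = (\<lambda>i\<in>I. if i = j then y j else \<zero>\<^bsub>Y i\<^esub>)" for j
  have e_in: "e j \<in> carrier ?S" if "j \<in> J" for j
  proof -
    have "{i \<in> I. e j i \<noteq> \<zero>\<^bsub>Y i\<^esub>} \<subseteq> {j}" by (auto simp: e_def)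
    then have "finite {i \<in> I. e j i \<noteq> \<zero>\<^bsub>Y i\<^esub>}" by (rule finite_subset) simp
    moreover have "e j \<in> (\<Pi>\<^sub>E i\<in>I. carrier (Y i))"
      using z y[OF that] by (auto simp: e_def)
    ultimately show ?thesis by (simp add: direct_sum_def)
  qed
  define h where "h = (\<lambda>j. inv_into (carrier M) \<phi> (e j))"
  have \<phi>h: "\<phi> (h j) = e j" if "j \<in> J" for j
    using bij e_in[OF that] by (simp add: h_def bij_betw_inv_into_right)
  have injh: "inj_on h J"
  proof (rule inj_onI)
    fix j k assume jk: "j \<in> J" "k \<in> J" "h j = h k"
    then have "e j j = e k j" using \<phi>h by metis
    then show "j = k" using y jk JI by (auto simp: e_def split: if_splits)
  qed
  define g where "g = inv_into J h"
  have gh: "g (h j) = j" if "j \<in> J" for j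
    using injh that by (simp add: g_def)
  have gJ: "g i \<in> J" if "i \<in> h ` J" for i
    using that gh by auto
  let ?T = "direct_sum (h ` J) (\<lambda>i. Y (g i))"
  define \<psi> where "\<psi> m = (\<lambda>i\<in>h ` J. \<phi> m (g i))" for m
  have \<phi>_in: "\<phi> m \<in> carrier ?S" if "m \<in> carrier M" for m
    using bij that by (auto simp: bij_betw_def)
  have \<psi>_in: "\<psi> m \<in> carrier ?T" if m: "m \<in> carrier M" for m
  proof -
    have fin: "finite {i \<in> I. \<phi> m i \<noteq> \<zero>\<^bsub>Y i\<^esub>}" and PiE: "\<phi> m \<in> (\<Pi>\<^sub>E i\<in>I. carrier (Y i))"
      using \<phi>_in[OF m] by (auto simp: direct_sum_def)
    have "{i \<in> h ` J. \<psi> m i \<noteq> \<zero>\<^bsub>Y (g i)\<^esub>} \<subseteq> h ` {i \<in> I. \<phi> m i \<noteq> \<zero>\<^bsub>Y i\<^esub>}"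
      using gh JI by (auto simp: \<psi>_def)
    then have "finite {i \<in> h ` J. \<psi> m i \<noteq> \<zero>\<^bsub>Y (g i)\<^esub>}"
      using fin by (meson finite_imageI finite_subset)
    moreover have "\<psi> m \<in> (\<Pi>\<^sub>E i\<in>h ` J. carrier (Y (g i)))"
      using PiE gJ JI by (auto simp: \<psi>_def gh PiE_iff subset_iff)
    ultimately show ?thesis by (simp add: direct_sum_def)
  qed
  have "\<psi> \<in> mod_hom R M ?T"
  proof -
    have "\<psi> (m \<oplus>\<^bsub>M\<^esub> m') = \<psi> m \<oplus>\<^bsub>?T\<^esub> \<psi> m'" if "m \<in> carrier M" "m' \<in> carrier M" for m m'
    proof -
      have "\<phi> (m \<oplus>\<^bsub>M\<^esub> m') = \<phi> m \<oplus>\<^bsub>?S\<^esub> \<phi> m'"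
        using \<phi> that by (auto simp: mod_hom_def hom_def)
      then show ?thesis
        using gJ JI by (auto simp: \<psi>_def direct_sum_def fun_eq_iff subset_iff gh)
    qed
    moreover have "\<psi> (a \<odot>\<^bsub>M\<^esub> m) = a \<odot>\<^bsub>?T\<^esub> \<psi> m" if "a \<in> carrier R" "m \<in> carrier M" for a m
    proof -
      have "\<phi> (a \<odot>\<^bsub>M\<^esub> m) = a \<odot>\<^bsub>?S\<^esub> \<phi> m"
        using \<phi> that by (auto simp: mod_hom_def)
      then show ?thesis
        using gJ JI by (auto simp: \<psi>_def direct_sum_def fun_eq_iff subset_iff gh)
    qed
    ultimately show ?thesis using \<psi>_in by (auto simp: mod_hom_def hom_def)
  qed
  moreover have "bij_betw \<psi> (carrier M) (carrier ?T)"
    unfolding bij_betw_def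
  proof
    show "inj_on \<psi> (carrier M)"
    proof (rule inj_onI)
      fix m m' assume m: "m \<in> carrier M" "m' \<in> carrier M" and eq: "\<psi> m = \<psi> m'"
      have "\<phi> m i = \<phi> m' i" if i: "i \<in> I" for i
      proof (cases "i \<in> J")
        case True
        then show ?thesis using fun_cong[OF eq, of "h i"] gh by (simp add: \<psi>_def)
      next
        case False
        then have "carrier (Y i) = {\<zero>\<^bsub>Y i\<^esub>}" using i by (simp add: J_def)
        then show ?thesis using \<phi>_in[OF m(1)] \<phi>_in[OF m(2)] i
          by (simp add: direct_sum_def PiE_iff) (metis singletonD)
      qed
      then have "\<phi> m = \<phi> m'"
        using \<phi>_in[OF m(1)] \<phi>_in[OF m(2)] by (auto simp: direct_sum_def intro: PiE_ext)
      then show "m = m'" using bij m by (auto simp: bij_betw_def dest: inj_onD)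
    qed
    show "\<psi> ` carrier M = carrier ?T"
    proof
      show "\<psi> ` carrier M \<subseteq> carrier ?T" using \<psi>_in by auto
      show "carrier ?T \<subseteq> \<psi> ` carrier M"
      proof
        fix t assume t: "t \<in> carrier ?T"
        define x where "x = (\<lambda>i\<in>I. if i \<in> J then t (h i) else \<zero>\<^bsub>Y i\<^esub>)"
        have tP: "t \<in> (\<Pi>\<^sub>E i\<in>h ` J. carrier (Y (g i)))"
          and tf: "finite {i \<in> h ` J. t i \<noteq> \<zero>\<^bsub>Y (g i)\<^esub>}"
          using t by (auto simp: direct_sum_def)
        have "{i \<in> I. x i \<noteq> \<zero>\<^bsub>Y i\<^esub>} \<subseteq> g ` {i \<in> h ` J. t i \<noteq> \<zero>\<^bsub>Y (g i)\<^esub>}"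
        proof
          fix i assume "i \<in> {i \<in> I. x i \<noteq> \<zero>\<^bsub>Y i\<^esub>}"
          then have "i \<in> J" "t (h i) \<noteq> \<zero>\<^bsub>Y i\<^esub>" by (auto simp: x_def split: if_splits)
          then show "i \<in> g ` {i \<in> h ` J. t i \<noteq> \<zero>\<^bsub>Y (g i)\<^esub>}"
            using gh by (intro image_eqI[of _ _ "h i"]) auto
        qed
        then have "finite {i \<in> I. x i \<noteq> \<zero>\<^bsub>Y i\<^esub>}"
          using tf by (meson finite_imageI finite_subset)
        moreover have "x \<in> (\<Pi>\<^sub>E i\<in>I. carrier (Y i))"
          using tP z gh by (fastforce simp: x_def PiE_iff)
        ultimately have "x \<in> carrier ?S" by (simp add: direct_sum_def)
        then obtain m where m: "m \<in> carrier M" "\<phi> m = x"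
          using bij by (metis bij_betw_imp_surj_on imageE)
        have "\<psi> m = t"
        proof
          fix i show "\<psi> m i = t i"
          proof (cases "i \<in> h ` J")
            case True
            then obtain j where "j \<in> J" "i = h j" by auto
            then show ?thesis using m JI gh by (auto simp: \<psi>_def x_def)
          next
            case False
            then show ?thesis using tP by (auto simp: \<psi>_def PiE_iff extensional_def)
          qed
        qed
        then show "t \<in> \<psi> ` carrier M" using m by auto
      qed
    qed
  qed
  ultimately have "mod_iso R M ?T" by (auto simp: mod_iso_def)
  moreover have "\<forall>i\<in>h ` J. Y (g i) \<in> \<X>" using gJ JI Y(1) by auto
  ultimately show ?thesis
    unfolding X_semisimple_def by (intro exI[of _ "h ` J"] exI[of _ "\<lambda>i. Y (g i)"]) auto
qed

end

theory Submission
  imports Defs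
begin

text \<open>
  Write \<open>M\<close> as a direct sum of bricks \<open>Y\<^sub>i\<close> and run Gaussian elimination with respect to a
  well-order on the index set.  For a submodule \<open>A\<close> of \<open>N\<close> call \<open>i\<close> a leading index of \<open>A\<close> if
  every element of \<open>Y\<^sub>i\<close> is the \<open>i\<close>-th component of some \<open>f x\<close>, \<open>x \<in> A\<close>, all of whose later
  components vanish.  Well-founded descent on the largest index of the support shows that the
  components of \<open>f a\<close>, \<open>a \<in> A\<close>, at the leading indices can be prescribed arbitrarily.
  Conversely, for each term of the filtration they determine \<open>f a\<close>.  This is preserved when a
  factor \<open>X\<close> is added: \<open>X\<close> then maps to each \<open>Y\<^sub>i\<close> by zero or by an isomorphism, only
  finitely many of these maps are nonzero since \<open>X\<close> is finitely generated, and the largest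
  index with a nonzero map becomes a leading index.  Hence the image of \<open>f\<close> is isomorphic to
  the sum of the \<open>Y\<^sub>i\<close> over the leading indices of \<open>N\<close>, and the sum over the other indices is a
  complement.
\<close>

section \<open>Homomorphisms of left modules\<close>

lemma mod_hom_iff:
  "f \<in> mod_hom R M N \<longleftrightarrow>
     (\<forall>x\<in>carrier M. f x \<in> carrier N) \<and>
     (\<forall>x\<in>carrier M. \<forall>y\<in>carrier M. f (x \<oplus>\<^bsub>M\<^esub> y) = f x \<oplus>\<^bsub>N\<^esub> f y) \<and>
     (\<forall>a\<in>carrier R. \<forall>x\<in>carrier M. f (a \<odot>\<^bsub>M\<^esub> x) = a \<odot>\<^bsub>N\<^esub> f x)"
  by (auto simp: mod_hom_def hom_def)

lemma mod_homI:
  assumes "\<And>x. x \<in> carrier M \<Longrightarrow> f x \<in> carrier N"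
    and "\<And>x y. \<lbrakk>x \<in> carrier M; y \<in> carrier M\<rbrakk> \<Longrightarrow> f (x \<oplus>\<^bsub>M\<^esub> y) = f x \<oplus>\<^bsub>N\<^esub> f y"
    and "\<And>a x. \<lbrakk>a \<in> carrier R; x \<in> carrier M\<rbrakk> \<Longrightarrow> f (a \<odot>\<^bsub>M\<^esub> x) = a \<odot>\<^bsub>N\<^esub> f x"
  shows "f \<in> mod_hom R M N"
  using assms by (simp add: mod_hom_iff)

lemma mod_hom_closed: "\<lbrakk>f \<in> mod_hom R M N; x \<in> carrier M\<rbrakk> \<Longrightarrow> f x \<in> carrier N"
  by (simp add: mod_hom_iff)

lemma mod_hom_add:
  "\<lbrakk>f \<in> mod_hom R M N; x \<in> carrier M; y \<in> carrier M\<rbrakk> \<Longrightarrow> f (x \<oplus>\<^bsub>M\<^esub> y) = f x \<oplus>\<^bsub>N\<^esub> f y"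
  by (simp add: mod_hom_iff)

lemma mod_hom_smult:
  "\<lbrakk>f \<in> mod_hom R M N; a \<in> carrier R; x \<in> carrier M\<rbrakk> \<Longrightarrow> f (a \<odot>\<^bsub>M\<^esub> x) = a \<odot>\<^bsub>N\<^esub> f x"
  by (simp add: mod_hom_iff)

lemma mod_hom_compose:
  "\<lbrakk>f \<in> mod_hom R L M; g \<in> mod_hom R M N\<rbrakk> \<Longrightarrow> (\<lambda>x. g (f x)) \<in> mod_hom R L N"
  by (simp add: mod_hom_iff)

lemma mod_hom_restrict_carrier:
  "\<lbrakk>f \<in> mod_hom R M N; H \<subseteq> carrier M\<rbrakk> \<Longrightarrow> f \<in> mod_hom R (M\<lparr>carrier := H\<rparr>) N"
  by (simp add: mod_hom_iff subset_iff)

lemma (in abelian_group) minus_self: "x \<in> carrier G \<Longrightarrow> x \<ominus> x = \<zero>"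
  by (simp add: a_minus_def r_neg)

lemma (in abelian_group) minus_eq_zeroD:
  assumes "x \<in> carrier G" "y \<in> carrier G" "x \<ominus> y = \<zero>"
  shows "x = y"
  using assms by (metis a_minus_def a_inv_closed add.inv_inv minus_equality)

lemma left_module_abelian_group: "left_module R M \<Longrightarrow> abelian_group M"
  by (simp add: left_module_def)

lemma mod_hom_abelian_group_hom:
  assumes "left_module R M" "left_module R N" "f \<in> mod_hom R M N"
  shows "abelian_group_hom M N f"
  using assms
  by (intro abelian_group_homI group_hom.intro group_hom_axioms.intro)
     (auto simp: left_module_def mod_hom_def abelian_group.a_group)

lemma mod_hom_zero:
  "\<lbrakk>left_module R M; left_module R N; f \<in> mod_hom R M N\<rbrakk> \<Longrightarrow> f \<zero>\<^bsub>M\<^esub> = \<zero>\<^bsub>N\<^esub>"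
  using mod_hom_abelian_group_hom abelian_group_hom.hom_zero by metis

lemma mod_hom_minus:
  assumes "left_module R M" "left_module R N" "f \<in> mod_hom R M N"
    and "x \<in> carrier M" "y \<in> carrier M"
  shows "f (x \<ominus>\<^bsub>M\<^esub> y) = f x \<ominus>\<^bsub>N\<^esub> f y"
proof -
  interpret abelian_group_hom M N f using mod_hom_abelian_group_hom assms(1-3) .
  show ?thesis using assms(4,5) by (simp add: a_minus_def)
qed

section \<open>Submodules, images and common kernels\<close>

lemma (in left_module) smult_r_zero:
  assumes a: "a \<in> carrier R"
  shows "a \<odot>\<^bsub>M\<^esub> \<zero>\<^bsub>M\<^esub> = \<zero>\<^bsub>M\<^esub>"
proof -
  have "a \<odot>\<^bsub>M\<^esub> \<zero>\<^bsub>M\<^esub> \<oplus>\<^bsub>M\<^esub> a \<odot>\<^bsub>M\<^esub> \<zero>\<^bsub>M\<^esub> = a \<odot>\<^bsub>M\<^esub> \<zero>\<^bsub>M\<^esub>"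
    using smult_r_distr[OF a M.zero_closed M.zero_closed] by simp
  then show ?thesis using a M.add.l_cancel_one by simp
qed

lemma (in left_module) left_submoduleI:
  assumes "H \<subseteq> carrier M" "\<zero>\<^bsub>M\<^esub> \<in> H"
    and minus: "\<And>x y. \<lbrakk>x \<in> H; y \<in> H\<rbrakk> \<Longrightarrow> x \<ominus>\<^bsub>M\<^esub> y \<in> H"
    and "\<And>a x. \<lbrakk>a \<in> carrier R; x \<in> H\<rbrakk> \<Longrightarrow> a \<odot>\<^bsub>M\<^esub> x \<in> H"
  shows "submodule H R M"
proof -
  have inv: "\<ominus>\<^bsub>M\<^esub> x \<in> H" if "x \<in> H" for x
    using minus[OF assms(2) that] assms(1) that by (auto simp: a_minus_def)
  have add: "x \<oplus>\<^bsub>M\<^esub> y \<in> H" if "x \<in> H" "y \<in> H" for x y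
    using minus[OF that(1) inv[OF that(2)]] assms(1) that by (auto simp: a_minus_def)
  show ?thesis
    using assms inv add
    by (intro submodule.intro subgroup.intro submodule_axioms.intro)
       (auto simp flip: a_inv_def)
qed

lemma submodule_subset: "submodule H R M \<Longrightarrow> H \<subseteq> carrier M"
  using submodule.axioms(1) subgroup.subset by fastforce

lemma submodule_zero: "submodule H R M \<Longrightarrow> \<zero>\<^bsub>M\<^esub> \<in> H"
  using submodule.axioms(1) subgroup.one_closed by fastforce

lemma submodule_add:
  "\<lbrakk>submodule H R M; x \<in> H; y \<in> H\<rbrakk> \<Longrightarrow> x \<oplus>\<^bsub>M\<^esub> y \<in> H"
  using submodule.axioms(1) subgroup.m_closed by fastforce

lemma submodule_minus:
  "\<lbrakk>submodule H R M; x \<in> H; y \<in> H\<rbrakk> \<Longrightarrow> x \<ominus>\<^bsub>M\<^esub> y \<in> H"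
  using submodule.axioms(1) subgroup.m_inv_closed submodule_add
  by (metis a_inv_def a_minus_def)

lemma (in left_module) left_module_submodule:
  assumes H: "submodule H R M"
  shows "left_module R (M\<lparr>carrier := H\<rparr>)"
proof -
  have sub: "H \<subseteq> carrier M" using submodule_subset[OF H] .
  have g: "subgroup H (add_monoid M)" using H submodule.axioms(1) by blast
  have "comm_group (add_monoid M\<lparr>carrier := H\<rparr>)"
    using sub M.a_comm subgroup.subgroup_is_group[OF g M.a_group]
    by (intro group.group_comm_groupI) (auto simp: subset_iff)
  then have "abelian_group (M\<lparr>carrier := H\<rparr>)"
    by (intro comm_group_abelian_groupI) simp
  then show ?thesis
    using sub H R.ring_axioms
    by (intro left_module.intro left_module_axioms.intro)
       (auto simp: subset_iff submodule.smult_closed smult_l_distr smult_r_distr smult_assoc1)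
qed

lemma submodule_of_submodule:
  assumes M: "left_module R M" and "submodule B R M" "submodule A R M" "A \<subseteq> B"
  shows "submodule A R (M\<lparr>carrier := B\<rparr>)"
proof -
  interpret left_module R M by fact
  have "subgroup A (add_monoid M\<lparr>carrier := B\<rparr>)"
    using assms M.a_group group.subgroup_incl[of "add_monoid M" A B]
    by (simp add: submodule_def)
  then show ?thesis
    using assms(3) by (auto simp: submodule_def submodule_axioms_def)
qed

lemma mod_hom_image_submodule:
  assumes M: "left_module R M" and N: "left_module R N" and f: "f \<in> mod_hom R M N"
  shows "submodule (f ` carrier M) R N"
proof -
  interpret M: left_module R M by fact
  interpret N: left_module R N by fact
  show ?thesis
  proof (rule N.left_submoduleI)
    show "f ` carrier M \<subseteq> carrier N" using mod_hom_closed[OF f] by auto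
    show "\<zero>\<^bsub>N\<^esub> \<in> f ` carrier M"
      using mod_hom_zero[OF M N f] by (metis M.zero_closed imageI)
    show "x \<ominus>\<^bsub>N\<^esub> y \<in> f ` carrier M" if "x \<in> f ` carrier M" "y \<in> f ` carrier M" for x y
      using that mod_hom_minus[OF M N f] by (smt (verit) M.minus_closed image_iff)
    show "a \<odot>\<^bsub>N\<^esub> x \<in> f ` carrier M" if "a \<in> carrier R" "x \<in> f ` carrier M" for a x
      using that mod_hom_smult[OF f] by (smt (verit) M.smult_closed image_iff)
  qed
qed

text \<open>Serves twice: it gives the elements of a filtration term that are reduced at the leading
  indices, and later the complement of the image.\<close>

lemma (in left_module) submodule_common_kernel:
  assumes B: "submodule B R M"
    and g: "\<And>l. l \<in> L \<Longrightarrow> left_module R (Y l)" "\<And>l. l \<in> L \<Longrightarrow> g l \<in> mod_hom R M (Y l)"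
  shows "submodule {x \<in> B. \<forall>l\<in>L. g l x = \<zero>\<^bsub>Y l\<^esub>} R M"
proof (rule left_submoduleI)
  have sub: "B \<subseteq> carrier M" using submodule_subset[OF B] .
  have m: "left_module R M" by (rule left_module_axioms)
  show "{x \<in> B. \<forall>l\<in>L. g l x = \<zero>\<^bsub>Y l\<^esub>} \<subseteq> carrier M" using sub by auto
  show "\<zero>\<^bsub>M\<^esub> \<in> {x \<in> B. \<forall>l\<in>L. g l x = \<zero>\<^bsub>Y l\<^esub>}"
    using submodule_zero[OF B] mod_hom_zero[OF m g] by auto
  fix x assume x: "x \<in> {x \<in> B. \<forall>l\<in>L. g l x = \<zero>\<^bsub>Y l\<^esub>}"
  show "x \<ominus>\<^bsub>M\<^esub> y \<in> {x \<in> B. \<forall>l\<in>L. g l x = \<zero>\<^bsub>Y l\<^esub>}"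
    if y: "y \<in> {x \<in> B. \<forall>l\<in>L. g l x = \<zero>\<^bsub>Y l\<^esub>}" for y
  proof -
    have "g l (x \<ominus>\<^bsub>M\<^esub> y) = \<zero>\<^bsub>Y l\<^esub>" if l: "l \<in> L" for l
    proof -
      interpret Yl: left_module R "Y l" using g(1)[OF l] .
      show ?thesis using x y l sub mod_hom_minus[OF m g(1)[OF l] g(2)[OF l], of x y]
        by (auto simp: Yl.minus_self)
    qed
    then show ?thesis using x y submodule_minus[OF B] by auto
  qed
  show "a \<odot>\<^bsub>M\<^esub> x \<in> {x \<in> B. \<forall>l\<in>L. g l x = \<zero>\<^bsub>Y l\<^esub>}" if a: "a \<in> carrier R" for a
    using x sub a submodule.smult_closed[OF B a] left_module.smult_r_zero[OF g(1) a]
    by (auto simp: mod_hom_smult[OF g(2) a] subset_iff)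
qed

section \<open>Factoring through surjections and quotients\<close>

text \<open>Two preimages under \<open>q\<close> differ by an element of its kernel, where
  \<open>g\<close> vanishes. So evaluating \<open>g\<close> at a chosen preimage does not depend on
  the choice, and additivity and linearity pass from \<open>g\<close> to \<open>t\<close>.\<close>

lemma mod_hom_factor:
  assumes D: "left_module R D" and X: "left_module R X" and Y: "left_module R Y"
    and q: "q \<in> mod_hom R D X" "q ` carrier D = carrier X"
    and g: "g \<in> mod_hom R D Y"
    and ker: "\<And>d. \<lbrakk>d \<in> carrier D; q d = \<zero>\<^bsub>X\<^esub>\<rbrakk> \<Longrightarrow> g d = \<zero>\<^bsub>Y\<^esub>"
  obtains t where "t \<in> mod_hom R X Y" "\<And>d. d \<in> carrier D \<Longrightarrow> t (q d) = g d"
proof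
  interpret D: left_module R D by fact
  interpret X: left_module R X by fact
  interpret Y: left_module R Y by fact
  define t where "t x = g (SOME d. d \<in> carrier D \<and> q d = x)" for x
  show tq: "t (q d) = g d" if d: "d \<in> carrier D" for d
  proof -
    let ?e = "SOME e. e \<in> carrier D \<and> q e = q d"
    have e: "?e \<in> carrier D \<and> q ?e = q d"
      by (rule someI[of _ d]) (simp add: d)
    then have "q (?e \<ominus>\<^bsub>D\<^esub> d) = \<zero>\<^bsub>X\<^esub>"
      using mod_hom_minus[OF D X q(1), of ?e d] d mod_hom_closed[OF q(1) d]
      by (simp add: X.minus_self)
    then have "g (?e \<ominus>\<^bsub>D\<^esub> d) = \<zero>\<^bsub>Y\<^esub>" using ker e d by simp
    then have "g ?e \<ominus>\<^bsub>Y\<^esub> g d = \<zero>\<^bsub>Y\<^esub>" using mod_hom_minus[OF D Y g, of ?e d] e d by simp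
    then show ?thesis
      using e d mod_hom_closed[OF g] Y.minus_eq_zeroD unfolding t_def by blast
  qed
  show "t \<in> mod_hom R X Y"
  proof (rule mod_homI)
    fix x assume "x \<in> carrier X"
    then obtain d where d: "d \<in> carrier D" "x = q d" using q(2) by auto
    then show "t x \<in> carrier Y" using tq mod_hom_closed[OF g] by simp
    show "t (a \<odot>\<^bsub>X\<^esub> x) = a \<odot>\<^bsub>Y\<^esub> t x" if a: "a \<in> carrier R" for a
      using d a tq[of "a \<odot>\<^bsub>D\<^esub> d"] mod_hom_smult[OF q(1) a d(1)] mod_hom_smult[OF g a d(1)]
      by (simp add: tq)
    fix y assume "y \<in> carrier X"
    then obtain e where e: "e \<in> carrier D" "y = q e" using q(2) by auto
    show "t (x \<oplus>\<^bsub>X\<^esub> y) = t x \<oplus>\<^bsub>Y\<^esub> t y"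
      using d e tq[of "d \<oplus>\<^bsub>D\<^esub> e"] mod_hom_add[OF q(1) d(1) e(1)] mod_hom_add[OF g d(1) e(1)]
      by (simp add: tq)
  qed
qed

lemma mod_hom_of_quotient_iso:
  assumes B: "left_module R B" and X: "left_module R X" and A: "submodule A R B"
    and iso: "mod_iso R (quotient_module B A) X"
  obtains q where "q \<in> mod_hom R B X" "q ` carrier B = carrier X"
    "\<And>b. b \<in> carrier B \<Longrightarrow> q b = \<zero>\<^bsub>X\<^esub> \<longleftrightarrow> b \<in> A"
proof -
  interpret B: left_module R B by fact
  interpret X: left_module R X by fact
  interpret A: abelian_subgroup A B
    using A B.a_comm_group by (intro abelian_subgroupI2) (auto simp: submodule_def)
  let ?Q = "quotient_module B A"
  obtain \<theta> where \<theta>: "\<theta> \<in> mod_hom R ?Q X" "bij_betw \<theta> (carrier ?Q) (carrier X)"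
    using iso by (auto simp: mod_iso_def)
  have cQ: "carrier ?Q = (\<lambda>b. A +>\<^bsub>B\<^esub> b) ` carrier B"
    by (auto simp: quotient_module_def A_RCOSETS_def RCOSETS_def a_r_coset_def)
  have proj: "(\<lambda>b. A +>\<^bsub>B\<^esub> b) \<in> mod_hom R B ?Q"
  proof (rule mod_homI)
    show "A +>\<^bsub>B\<^esub> b \<in> carrier ?Q" if "b \<in> carrier B" for b using that cQ by auto
    show "A +>\<^bsub>B\<^esub> (b \<oplus>\<^bsub>B\<^esub> c) = (A +>\<^bsub>B\<^esub> b) \<oplus>\<^bsub>?Q\<^esub> (A +>\<^bsub>B\<^esub> c)"
      if "b \<in> carrier B" "c \<in> carrier B" for b c
      using that A.a_rcos_sum by (simp add: quotient_module_def)
    fix a b assume a: "a \<in> carrier R" and b: "b \<in> carrier B"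
    \<comment> \<open>Scalar multiplication on the quotient is a union over all representatives. As
      \<open>A\<close> is closed under scalars, each representative contributes the same coset, so
      the nonempty union is that coset.\<close>
    have coset: "A +>\<^bsub>B\<^esub> (a \<odot>\<^bsub>B\<^esub> x) = A +>\<^bsub>B\<^esub> (a \<odot>\<^bsub>B\<^esub> b)" if x: "x \<in> A +>\<^bsub>B\<^esub> b" for x
    proof -
      obtain h where h: "h \<in> A" "x = h \<oplus>\<^bsub>B\<^esub> b"
        using x by (auto simp: a_r_coset_def')
      have hB: "h \<in> carrier B" using h A.a_subset by auto
      have "a \<odot>\<^bsub>B\<^esub> x = a \<odot>\<^bsub>B\<^esub> h \<oplus>\<^bsub>B\<^esub> a \<odot>\<^bsub>B\<^esub> b"
        using h hB a b by (simp add: B.smult_r_distr)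
      moreover have "a \<odot>\<^bsub>B\<^esub> h \<in> A" using submodule.smult_closed[OF A a h(1)] .
      ultimately have "a \<odot>\<^bsub>B\<^esub> x \<in> A +>\<^bsub>B\<^esub> (a \<odot>\<^bsub>B\<^esub> b)"
        by (auto simp: a_r_coset_def')
      then show ?thesis
        using B.a_repr_independence[OF _ B.smult_closed[OF a b] A.a_subgroup] by simp
    qed
    have "A +>\<^bsub>B\<^esub> b \<noteq> {}" using b A.a_rcos_self by blast
    then have "(\<Union>x\<in>A +>\<^bsub>B\<^esub> b. A +>\<^bsub>B\<^esub> (a \<odot>\<^bsub>B\<^esub> x)) = A +>\<^bsub>B\<^esub> (a \<odot>\<^bsub>B\<^esub> b)"
      by (rule SUP_eq_const) (rule coset)
    then show "A +>\<^bsub>B\<^esub> (a \<odot>\<^bsub>B\<^esub> b) = a \<odot>\<^bsub>?Q\<^esub> (A +>\<^bsub>B\<^esub> b)"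
      by (simp add: quotient_module_def)
  qed
  define q where "q b = \<theta> (A +>\<^bsub>B\<^esub> b)" for b
  have q: "q \<in> mod_hom R B X"
    unfolding q_def using mod_hom_compose[OF proj \<theta>(1)] .
  have "q ` carrier B = carrier X"
    using \<theta>(2) cQ by (auto simp: bij_betw_def q_def image_image)
  moreover have "q b = \<zero>\<^bsub>X\<^esub> \<longleftrightarrow> b \<in> A" if b: "b \<in> carrier B" for b
  proof -
    \<comment> \<open>Writing zero as the image of zero lets injectivity of \<open>\<theta>\<close>
      turn the condition into an equality of cosets.\<close>
    have "q b = q \<zero>\<^bsub>B\<^esub> \<longleftrightarrow> A +>\<^bsub>B\<^esub> b = A +>\<^bsub>B\<^esub> \<zero>\<^bsub>B\<^esub>"
      unfolding q_def using \<theta>(2) b cQ B.zero_closed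
      by (metis bij_betw_imp_inj_on image_eqI inj_on_eq_iff)
    also have "\<dots> \<longleftrightarrow> b \<in> A"
      using b B.a_coset_add_zero[OF A.a_subset] A.a_rcos_self[OF b] A.a_rcos_const by auto
    finally show ?thesis using mod_hom_zero[OF B X q] by simp
  qed
  ultimately show ?thesis using that q by blast
qed

section \<open>Maps between bricks and finite generation\<close>

text \<open>A Schur-type argument: distinct members of a semibrick admit only the zero map, so a
  nonzero \<open>t\<close> is an endomorphism of one brick, hence a unit of its endomorphism
  ring.\<close>

lemma semibrick_hom_zero_or_bij:
  assumes sb: "semibrick R \<X>" and X: "X \<in> \<X>" "X' \<in> \<X>" and t: "t \<in> mod_hom R X X'"
    and nz: "x \<in> carrier X" "t x \<noteq> \<zero>\<^bsub>X'\<^esub>"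
  shows "bij_betw t (carrier X) (carrier X')"
proof -
  have eq: "X' = X" using sb X t nz unfolding semibrick_def by metis
  have lm: "left_module R X" and div: "is_division_ring (end_ring R X)"
    using sb X by (auto simp: semibrick_def brick_def)
  interpret X: left_module R X by fact
  \<comment> \<open>The endomorphism ring contains extensional maps only, so \<open>t\<close> must
    be cut down to the carrier first.\<close>
  let ?t = "restrict t (carrier X)"
  have "?t \<in> carrier (end_ring R X)"
    using t eq by (auto simp: end_ring_def mod_hom_iff)
  moreover have "?t \<noteq> \<zero>\<^bsub>end_ring R X\<^esub>"
    using nz eq by (auto simp: end_ring_def fun_eq_iff)
  ultimately have "?t \<in> Units (end_ring R X)"
    using div by (simp add: is_division_ring_def)
  then obtain s where s: "s \<in> carrier (end_ring R X)"
    "s \<otimes>\<^bsub>end_ring R X\<^esub> ?t = \<one>\<^bsub>end_ring R X\<^esub>" "?t \<otimes>\<^bsub>end_ring R X\<^esub> s = \<one>\<^bsub>end_ring R X\<^esub>"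
    by (auto simp: Units_def)
  have sX: "s y \<in> carrier X" if "y \<in> carrier X" for y
    using s(1) that by (auto simp: end_ring_def mod_hom_iff)
  have "s (t y) = y" if "y \<in> carrier X" for y
    using fun_cong[OF s(2), of y] that by (simp add: end_ring_def compose_def)
  moreover have "t (s y) = y" if "y \<in> carrier X" for y
    using fun_cong[OF s(3), of y] that sX by (simp add: end_ring_def compose_def)
  ultimately show ?thesis
    using sX t eq by (intro bij_betw_byWitness[where f' = s]) (auto simp: mod_hom_iff)
qed

text \<open>The standard basis vectors generate the free module; the proof strips off one coordinate
  at a time.\<close>

lemma free_module_hom_eq_zero:
  assumes R: "ring R" and Y: "left_module R Y" and u: "u \<in> mod_hom R (free_module R n) Y"
    and basis: "\<And>k. k < n \<Longrightarrow> u (\<lambda>j\<in>{..<n}. if j = k then \<one>\<^bsub>R\<^esub> else \<zero>\<^bsub>R\<^esub>) = \<zero>\<^bsub>Y\<^esub>"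
    and x: "x \<in> carrier (free_module R n)"
  shows "u x = \<zero>\<^bsub>Y\<^esub>"
proof -
  interpret R: ring R by fact
  interpret Y: left_module R Y by fact
  let ?F = "free_module R n"
  let ?e = "\<lambda>k. \<lambda>j\<in>{..<n}. if j = k then \<one>\<^bsub>R\<^esub> else \<zero>\<^bsub>R\<^esub>"
  have cF: "carrier ?F = ({..<n} \<rightarrow>\<^sub>E carrier R)"
    by (auto simp: free_module_def direct_sum_def regular_module_def)
  have addF: "y \<oplus>\<^bsub>?F\<^esub> z = (\<lambda>i\<in>{..<n}. y i \<oplus>\<^bsub>R\<^esub> z i)" for y z
    by (simp add: free_module_def direct_sum_def regular_module_def)
  have smF: "a \<odot>\<^bsub>?F\<^esub> z = (\<lambda>i\<in>{..<n}. a \<otimes>\<^bsub>R\<^esub> z i)" for a z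
    by (simp add: free_module_def direct_sum_def regular_module_def)
  have eF: "?e k \<in> carrier ?F" for k by (auto simp: cF)
  \<comment> \<open>Induction on a bound \<open>m\<close> from which on the coordinates of
    \<open>z\<close> vanish; \<open>m = n\<close> imposes no condition.\<close>
  have "u z = \<zero>\<^bsub>Y\<^esub>" if "m \<le> n" "z \<in> carrier ?F" "\<And>k. \<lbrakk>m \<le> k; k < n\<rbrakk> \<Longrightarrow> z k = \<zero>\<^bsub>R\<^esub>" for m z
    using that
  proof (induction m arbitrary: z)
    case 0
    \<comment> \<open>Here all coordinates of \<open>z\<close> are zero, so \<open>u z\<close>
      equals its own double and must vanish.\<close>
    have "z \<oplus>\<^bsub>?F\<^esub> z = z"
      using 0 by (auto simp: addF cF PiE_iff extensional_def fun_eq_iff)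
    then have "u z \<oplus>\<^bsub>Y\<^esub> u z = u z" using mod_hom_add[OF u] 0 by metis
    then show ?case using mod_hom_closed[OF u 0(2)] Y.add.l_cancel_one by simp
  next
    case (Suc m)
    let ?z = "z(m := \<zero>\<^bsub>R\<^esub>)"
    have zm: "z m \<in> carrier R" using Suc.prems by (auto simp: cF PiE_iff)
    have zF: "?z \<in> carrier ?F" using Suc.prems by (auto simp: cF PiE_iff extensional_def)
    have "u ?z = \<zero>\<^bsub>Y\<^esub>" using Suc.prems by (intro Suc.IH[OF _ zF]) auto
    moreover have "z = ?z \<oplus>\<^bsub>?F\<^esub> z m \<odot>\<^bsub>?F\<^esub> ?e m"
      using Suc.prems zm by (auto simp: addF smF cF PiE_iff extensional_def fun_eq_iff)
    moreover have "u (z m \<odot>\<^bsub>?F\<^esub> ?e m) = \<zero>\<^bsub>Y\<^esub>"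
      using mod_hom_smult[OF u zm eF] basis Suc.prems(1) zm Y.smult_r_zero by simp
    moreover have "z m \<odot>\<^bsub>?F\<^esub> ?e m \<in> carrier ?F" using zm by (auto simp: smF cF)
    ultimately show ?case using mod_hom_add[OF u zF, of "z m \<odot>\<^bsub>?F\<^esub> ?e m"]
      by (metis Y.zero_closed Y.l_zero)
  qed
  then show ?thesis using x by (metis le_refl not_le)
qed

text \<open>The images under \<open>p\<close> of the basis vectors generate \<open>X\<close>, so a
  nonzero \<open>t i\<close> is nonzero on one of them. Finiteness at each single element thus gives
  finiteness for the whole family.\<close>

lemma finitely_presented_finite_support:
  assumes R: "ring R" and fp: "finitely_presented R X"
    and Y: "\<And>i. i \<in> I \<Longrightarrow> left_module R (Y i)"
    and t: "\<And>i. i \<in> I \<Longrightarrow> t i \<in> mod_hom R X (Y i)"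
    and fin: "\<And>x. x \<in> carrier X \<Longrightarrow> finite {i \<in> I. t i x \<noteq> \<zero>\<^bsub>Y i\<^esub>}"
  shows "finite {i \<in> I. \<exists>x\<in>carrier X. t i x \<noteq> \<zero>\<^bsub>Y i\<^esub>}"
proof -
  interpret R: ring R by fact
  obtain n p where p: "p \<in> mod_hom R (free_module R n) X"
    "p ` carrier (free_module R n) = carrier X"
    using fp by (auto simp: finitely_presented_def)
  let ?e = "\<lambda>k. \<lambda>j\<in>{..<n}. if j = k then \<one>\<^bsub>R\<^esub> else \<zero>\<^bsub>R\<^esub>"
  let ?S = "\<Union>k<n. {i \<in> I. t i (p (?e k)) \<noteq> \<zero>\<^bsub>Y i\<^esub>}"
  have e: "?e k \<in> carrier (free_module R n)" for k
    by (auto simp: free_module_def direct_sum_def regular_module_def)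
  have "t i x = \<zero>\<^bsub>Y i\<^esub>" if i: "i \<in> I" "i \<notin> ?S" and x: "x \<in> carrier X" for i x
  proof -
    obtain z where z: "z \<in> carrier (free_module R n)" "x = p z" using x p(2) by auto
    have "t i (p z) = \<zero>\<^bsub>Y i\<^esub>"
      by (rule free_module_hom_eq_zero[OF R Y[OF i(1)] mod_hom_compose[OF p(1) t[OF i(1)]] _ z(1)])
         (use i in auto)
    then show ?thesis using z by simp
  qed
  then have "{i \<in> I. \<exists>x\<in>carrier X. t i x \<noteq> \<zero>\<^bsub>Y i\<^esub>} \<subseteq> ?S" by blast
  moreover have "finite ?S" using fin mod_hom_closed[OF p(1) e] by auto
  ultimately show ?thesis by (rule finite_subset)
qed

section \<open>Leading indices and elimination\<close>

text \<open>The maps \<open>g i\<close> are the components of a homomorphism into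
  \<open>direct_sum I Y\<close>; \<open>finite_support\<close> says that its values lie there. The
  strict well-order is a parameter because the index type carries no order of its own.\<close>

locale hom_family = left_module R N
  for R :: "('a, 'r) ring_scheme" and N :: "('a, 'c) module" +
  fixes I :: "'i set" and Y :: "'i \<Rightarrow> ('a, 'b) module" and g :: "'i \<Rightarrow> 'c \<Rightarrow> 'b"
    and less :: "'i \<Rightarrow> 'i \<Rightarrow> bool"  (infix \<open>\<prec>\<close> 50)
  assumes Y: "i \<in> I \<Longrightarrow> left_module R (Y i)"
    and g: "i \<in> I \<Longrightarrow> g i \<in> mod_hom R N (Y i)"
    and finite_support: "x \<in> carrier N \<Longrightarrow> finite {i \<in> I. g i x \<noteq> \<zero>\<^bsub>Y i\<^esub>}"
    and wf: "wfp (\<prec>)" and trans: "transp (\<prec>)" and total: "totalp (\<prec>)"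
begin

text \<open>These indices act as pivots. Asking for every element of \<open>Y i\<close>, not just a
  nonzero one, allows any value at a pivot to be cleared by a single subtraction.\<close>

definition lead :: "'c set \<Rightarrow> 'i set" where
  "lead A = {i \<in> I. \<forall>y\<in>carrier (Y i). \<exists>x\<in>A. g i x = y \<and> (\<forall>j\<in>I. i \<prec> j \<longrightarrow> g j x = \<zero>\<^bsub>Y j\<^esub>)}"

lemma lead_subset: "lead A \<subseteq> I"
  by (auto simp: lead_def)

lemma lead_mono: "A \<subseteq> B \<Longrightarrow> lead A \<subseteq> lead B"
  unfolding lead_def by blast

lemma irrefl: "\<not> i \<prec> i"
  using wf by (metis wfp_imp_irreflp irreflpD)

lemma finite_greatest:
  assumes "finite S" "S \<noteq> {}"
  obtains s where "s \<in> S" "\<And>j. s \<prec> j \<Longrightarrow> j \<notin> S"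
proof -
  have "asymp (\<prec>)" using wf wfp_imp_asymp by blast
  then obtain s where "s \<in> S" "\<forall>x\<in>S. x \<noteq> s \<longrightarrow> \<not> s \<prec> x"
    using Finite_Set.bex_max_element[OF assms(1) _ _ assms(2), of "(\<prec>)"] trans
    by (meson asymp_on_subset transp_on_subset subset_UNIV)
  then show ?thesis using that irrefl by metis
qed

text \<open>Clearing the greatest pivot in the support of \<open>y\<close> disturbs only smaller
  indices, so repeated clearing descends along the well-order and stops.\<close>

lemma lead_interpolation:
  assumes A: "submodule A R N" and y: "y \<in> carrier (direct_sum I Y)"
  obtains a where "a \<in> A" "\<And>l. l \<in> lead A \<Longrightarrow> g l a = y l"
proof -
  let ?supp = "\<lambda>y. {l \<in> lead A. y l \<noteq> \<zero>\<^bsub>Y l\<^esub>}"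
  have AN: "a \<in> carrier N" if "a \<in> A" for a using submodule_subset[OF A] that by auto
  have fin: "finite (?supp y)" if "y \<in> carrier (direct_sum I Y)" for y
    using that lead_subset[of A]
    by (auto simp: direct_sum_def intro: finite_subset[of _ "{i \<in> I. y i \<noteq> \<zero>\<^bsub>Y i\<^esub>}"])
  have triv: "\<exists>a\<in>A. \<forall>l\<in>lead A. g l a = y l" if "?supp y = {}" for y
    using that submodule_zero[OF A] mod_hom_zero[OF left_module_axioms Y g] lead_subset by force
  \<comment> \<open>The induction runs over the greatest pivot \<open>m\<close> in the support, with
    the target \<open>y\<close> kept arbitrary because it changes at each round.\<close>
  have step: "\<exists>a\<in>A. \<forall>l\<in>lead A. g l a = y l"
    if "y \<in> carrier (direct_sum I Y)" "m \<in> ?supp y" "\<And>j. m \<prec> j \<Longrightarrow> j \<notin> ?supp y" for m y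
    using that
  proof (induction m arbitrary: y rule: wfp_induct_rule[OF wf])
    case (1 m)
    note IH = 1(1) and y = 1(2) and m = 1(3,4)
    have yI: "y i \<in> carrier (Y i)" if "i \<in> I" for i
      using y that by (auto simp: direct_sum_def)
    have mI: "m \<in> I" using m(1) lead_subset by auto
    obtain b where b: "b \<in> A" "g m b = y m" "\<And>j. \<lbrakk>j \<in> I; m \<prec> j\<rbrakk> \<Longrightarrow> g j b = \<zero>\<^bsub>Y j\<^esub>"
      using m(1) yI[OF mI] unfolding lead_def by blast
    \<comment> \<open>What is left of the target after \<open>b\<close> has supplied the value at
      \<open>m\<close>.\<close>
    define z where "z = (\<lambda>i\<in>I. y i \<ominus>\<^bsub>Y i\<^esub> g i b)"
    have gb: "g i b \<in> carrier (Y i)" if "i \<in> I" for i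
      using mod_hom_closed[OF g[OF that] AN[OF b(1)]] .
    have diff: "u \<ominus>\<^bsub>Y i\<^esub> u = \<zero>\<^bsub>Y i\<^esub>" if "i \<in> I" "u \<in> carrier (Y i)" for i u
      using abelian_group.minus_self[OF left_module_abelian_group[OF Y]] that by blast
    have z: "z \<in> carrier (direct_sum I Y)"
    proof -
      have "{i \<in> I. z i \<noteq> \<zero>\<^bsub>Y i\<^esub>} \<subseteq> {i \<in> I. y i \<noteq> \<zero>\<^bsub>Y i\<^esub>} \<union> {i \<in> I. g i b \<noteq> \<zero>\<^bsub>Y i\<^esub>}"
      proof
        fix i assume i: "i \<in> {i \<in> I. z i \<noteq> \<zero>\<^bsub>Y i\<^esub>}"
        then have "\<not> (y i = \<zero>\<^bsub>Y i\<^esub> \<and> g i b = \<zero>\<^bsub>Y i\<^esub>)"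
          using diff[of i "y i"] yI by (auto simp: z_def)
        then show "i \<in> {i \<in> I. y i \<noteq> \<zero>\<^bsub>Y i\<^esub>} \<union> {i \<in> I. g i b \<noteq> \<zero>\<^bsub>Y i\<^esub>}"
          using i by auto
      qed
      moreover have "finite \<dots>"
        using y finite_support[OF AN[OF b(1)]] by (simp add: direct_sum_def)
      ultimately have "finite {i \<in> I. z i \<noteq> \<zero>\<^bsub>Y i\<^esub>}" by (rule finite_subset)
      moreover have "z i \<in> carrier (Y i)" if "i \<in> I" for i
        using that yI gb abelian_group.minus_closed[OF left_module_abelian_group[OF Y]]
        by (simp add: z_def)
      ultimately show ?thesis by (auto simp: direct_sum_def z_def)
    qed
    \<comment> \<open>By totality the other cases are \<open>l = m\<close>, where \<open>b\<close>
      matches \<open>y\<close>, and \<open>m \<prec> l\<close>, where both \<open>y\<close> and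
      \<open>b\<close> vanish by the choice of \<open>m\<close> and \<open>b\<close>.\<close>
    have supp_z: "l \<prec> m" if "l \<in> ?supp z" for l
    proof (rule ccontr)
      assume "\<not> l \<prec> m"
      then have "l = m \<or> m \<prec> l" using total by (metis totalpD)
      moreover have "l \<in> I" using that lead_subset by auto
      moreover from calculation have "y l = g l b"
        using b(2) b(3)[of l] m(2)[of l] that by auto
      ultimately have "z l = \<zero>\<^bsub>Y l\<^esub>"
        using gb diff by (simp add: z_def)
      then show False using that by simp
    qed
    \<comment> \<open>An empty support has no greatest index for the induction hypothesis, so zero
      is used there instead.\<close>
    have "\<exists>a\<in>A. \<forall>l\<in>lead A. g l a = z l"
    proof (cases "?supp z = {}")
      case True
      then show ?thesis by (rule triv)
    next
      case False
      obtain k where k: "k \<in> ?supp z" "\<And>j. k \<prec> j \<Longrightarrow> j \<notin> ?supp z"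
        using finite_greatest[OF fin[OF z] False] by blast
      show ?thesis using IH[OF supp_z[OF k(1)] z k] by blast
    qed
    then obtain a where a: "a \<in> A" "\<And>l. l \<in> lead A \<Longrightarrow> g l a = z l" by blast
    have "g l (a \<oplus>\<^bsub>N\<^esub> b) = y l" if l: "l \<in> lead A" for l
    proof -
      have lI: "l \<in> I" using l lead_subset by auto
      interpret Yl: left_module R "Y l" using Y[OF lI] .
      have "g l (a \<oplus>\<^bsub>N\<^esub> b) = (y l \<ominus>\<^bsub>Y l\<^esub> g l b) \<oplus>\<^bsub>Y l\<^esub> g l b"
        using mod_hom_add[OF g[OF lI] AN[OF a(1)] AN[OF b(1)]] a(2)[OF l] lI by (simp add: z_def)
      also have "\<dots> = y l"
        using yI[OF lI] gb[OF lI] by (simp add: a_minus_def Yl.a_assoc Yl.l_neg)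
      finally show ?thesis .
    qed
    then show ?case using submodule_add[OF A a(1) b(1)] by blast
  qed
  have "\<exists>a\<in>A. \<forall>l\<in>lead A. g l a = y l"
  proof (cases "?supp y = {}")
    case True
    then show ?thesis by (rule triv)
  next
    case False
    obtain m where "m \<in> ?supp y" "\<And>j. m \<prec> j \<Longrightarrow> j \<notin> ?supp y"
      using finite_greatest[OF fin[OF y] False] by blast
    then show ?thesis by (rule step[OF y])
  qed
  then show ?thesis using that by blast
qed

section \<open>Passing along the filtration\<close>

text \<open>For a submodule \<open>A\<close>, this kernel form says by taking differences that the
  components at the pivots determine all components. It is the invariant carried along the
  filtration.\<close>

definition lead_determined :: "'c set \<Rightarrow> bool" where
  "lead_determined A \<longleftrightarrow>
     (\<forall>x\<in>A. (\<forall>l\<in>lead A. g l x = \<zero>\<^bsub>Y l\<^esub>) \<longrightarrow> (\<forall>i\<in>I. g i x = \<zero>\<^bsub>Y i\<^esub>))"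

lemma hom_family_in_direct_sum:
  assumes "x \<in> carrier N"
  shows "(\<lambda>i\<in>I. g i x) \<in> carrier (direct_sum I Y)"
proof -
  have "{i \<in> I. (\<lambda>i\<in>I. g i x) i \<noteq> \<zero>\<^bsub>Y i\<^esub>} = {i \<in> I. g i x \<noteq> \<zero>\<^bsub>Y i\<^esub>}" by auto
  then show ?thesis
    using finite_support[OF assms] mod_hom_closed[OF g assms] by (auto simp: direct_sum_def)
qed

text \<open>Reducing \<open>B\<close> at the pivots of \<open>A\<close> leaves a submodule
  \<open>D\<close> on which all components factor through \<open>X\<close>. Either they all vanish,
  or the greatest index with a nonzero factor is a pivot of \<open>B\<close> that detects the class
  in \<open>X\<close>.\<close>

lemma lead_determined_extension:
  assumes sb: "semibrick R \<X>" and YX: "\<And>i. i \<in> I \<Longrightarrow> Y i \<in> \<X>" and X: "X \<in> \<X>"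
    and A: "submodule A R N" and B: "submodule B R N" and AB: "A \<subseteq> B"
    and iso: "mod_iso R (quotient_module (N\<lparr>carrier := B\<rparr>) A) X"
    and det: "lead_determined A"
  shows "lead_determined B"
proof -
  have lmX: "left_module R X" and fpX: "finitely_presented R X"
    using sb X by (auto simp: semibrick_def brick_def)
  have BN: "B \<subseteq> carrier N" using submodule_subset[OF B] .
  have lmB: "left_module R (N\<lparr>carrier := B\<rparr>)" using left_module_submodule[OF B] .
  obtain q where q: "q \<in> mod_hom R (N\<lparr>carrier := B\<rparr>) X" "q ` B = carrier X"
    and kerq: "\<And>b. b \<in> B \<Longrightarrow> q b = \<zero>\<^bsub>X\<^esub> \<longleftrightarrow> b \<in> A"
    using mod_hom_of_quotient_iso[OF lmB lmX submodule_of_submodule[OF left_module_axioms B A AB] iso]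
    by auto
  define D where "D = {d \<in> B. \<forall>l\<in>lead A. g l d = \<zero>\<^bsub>Y l\<^esub>}"
  have D: "submodule D R N"
    unfolding D_def using lead_subset Y g by (intro submodule_common_kernel[OF B]) auto
  have DN: "D \<subseteq> carrier N" using submodule_subset[OF D] .
  have DB: "D \<subseteq> B" by (auto simp: D_def)
  have lmD: "left_module R (N\<lparr>carrier := D\<rparr>)" using left_module_submodule[OF D] .
  have qD: "q \<in> mod_hom R (N\<lparr>carrier := D\<rparr>) X"
    using mod_hom_restrict_carrier[OF q(1), of D] DB by simp
  have qD_onto: "q ` D = carrier X"
  proof
    show "q ` D \<subseteq> carrier X" using q(2) DB by auto
    show "carrier X \<subseteq> q ` D"
    proof
      fix x assume x: "x \<in> carrier X"
      then obtain b where b: "b \<in> B" "q b = x" using q(2) by (metis imageE)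
      \<comment> \<open>Take from \<open>A\<close> an element with the same pivot components as
        \<open>b\<close>. The difference lies in \<open>D\<close>, and its image in \<open>X\<close>
        is still \<open>x\<close> because \<open>q\<close> kills \<open>A\<close>.\<close>
      obtain a where a: "a \<in> A" "\<And>l. l \<in> lead A \<Longrightarrow> g l a = (\<lambda>i\<in>I. g i b) l"
        by (rule lead_interpolation[OF A hom_family_in_direct_sum[OF subsetD[OF BN b(1)]]])
           (rule that)
      have aB: "\<ominus>\<^bsub>N\<^esub> a \<in> A"
        using submodule_minus[OF A submodule_zero[OF A] a(1)] a AB BN by (auto simp: a_minus_def)
      have "g l (b \<ominus>\<^bsub>N\<^esub> a) = \<zero>\<^bsub>Y l\<^esub>" if l: "l \<in> lead A" for l
      proof -
        have lI: "l \<in> I" using l lead_subset by auto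
        interpret Yl: left_module R "Y l" using Y[OF lI] .
        show ?thesis
          using mod_hom_minus[OF left_module_axioms Y[OF lI] g[OF lI], of b a]
            a(1) a(2)[OF l] b(1) AB BN lI mod_hom_closed[OF g[OF lI], of b]
          by (auto simp: Yl.minus_self)
      qed
      then have "b \<ominus>\<^bsub>N\<^esub> a \<in> D" using submodule_minus[OF B b(1)] a(1) AB by (auto simp: D_def)
      moreover have "q (b \<ominus>\<^bsub>N\<^esub> a) = x"
      proof -
        interpret X: left_module R X by fact
        have "q (b \<oplus>\<^bsub>N\<^esub> \<ominus>\<^bsub>N\<^esub> a) = q b \<oplus>\<^bsub>X\<^esub> q (\<ominus>\<^bsub>N\<^esub> a)"
          using mod_hom_add[OF q(1), of b "\<ominus>\<^bsub>N\<^esub> a"] b aB AB by auto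
        then show ?thesis using kerq[of "\<ominus>\<^bsub>N\<^esub> a"] aB AB x b(2) by (auto simp: a_minus_def)
      qed
      ultimately show "x \<in> q ` D" by (metis imageI)
    qed
  qed
  \<comment> \<open>An element of \<open>D\<close> killed by \<open>q\<close> lies in
    \<open>A\<close> and vanishes at the pivots of \<open>A\<close>, so the invariant for
    \<open>A\<close> applies.\<close>
  have kerD: "g i d = \<zero>\<^bsub>Y i\<^esub>" if "d \<in> D" "q d = \<zero>\<^bsub>X\<^esub>" "i \<in> I" for d i
    using that kerq[of d] det unfolding D_def lead_determined_def by blast
  have "\<exists>t. t \<in> mod_hom R X (Y i) \<and> (\<forall>d\<in>D. t (q d) = g i d)" if i: "i \<in> I" for i
    by (rule mod_hom_factor[OF lmD lmX Y[OF i] qD _ mod_hom_restrict_carrier[OF g[OF i] DN]])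
       (use qD_onto kerD i in auto)
  then obtain t where t: "\<And>i. i \<in> I \<Longrightarrow> t i \<in> mod_hom R X (Y i)"
    and tq: "\<And>i d. \<lbrakk>i \<in> I; d \<in> D\<rbrakk> \<Longrightarrow> t i (q d) = g i d"
    by metis
  have fin: "finite {i \<in> I. t i x \<noteq> \<zero>\<^bsub>Y i\<^esub>}" if x: "x \<in> carrier X" for x
  proof -
    obtain d where d: "d \<in> D" "x = q d" using x qD_onto by auto
    then have "{i \<in> I. t i x \<noteq> \<zero>\<^bsub>Y i\<^esub>} = {i \<in> I. g i d \<noteq> \<zero>\<^bsub>Y i\<^esub>}" using tq by auto
    then show ?thesis using finite_support d DN by auto
  qed
  \<comment> \<open>Finite presentation of \<open>X\<close> enters here: it provides the finite set
    of nonzero factors in which a greatest index can be chosen.\<close>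
  have finS: "finite {i \<in> I. \<exists>x\<in>carrier X. t i x \<noteq> \<zero>\<^bsub>Y i\<^esub>}" (is "finite ?S")
    by (rule finitely_presented_finite_support[where I = I and Y = Y and t = t,
          OF R.ring_axioms fpX Y t fin])
  show ?thesis
  proof (cases "?S = {}")
    case True
    \<comment> \<open>Pivots of \<open>A\<close> remain pivots of \<open>B\<close>, so an element of
      \<open>B\<close> vanishing at the latter lies in \<open>D\<close>, where nothing
      survives.\<close>
    then have "g i d = \<zero>\<^bsub>Y i\<^esub>" if "d \<in> D" "i \<in> I" for i d
      using that tq[OF that(2,1), symmetric] mod_hom_closed[OF qD, of d] by auto
    then show ?thesis
      using lead_mono[OF AB] unfolding lead_determined_def D_def by blast
  next
    case False
    obtain m where m: "m \<in> ?S" "\<And>j. m \<prec> j \<Longrightarrow> j \<notin> ?S"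
      using finite_greatest[OF finS False] by blast
    have mI: "m \<in> I" using m(1) by auto
    have bij: "bij_betw (t m) (carrier X) (carrier (Y m))"
      using m(1) semibrick_hom_zero_or_bij[OF sb X YX t] by blast
    \<comment> \<open>Surjectivity of \<open>t m\<close> yields each value at \<open>m\<close>,
      lifted to \<open>D\<close>; the later components vanish because \<open>m\<close> is greatest
      in \<open>?S\<close>.\<close>
    have lead: "m \<in> lead B"
      unfolding lead_def
    proof (intro CollectI conjI ballI mI)
      fix y assume "y \<in> carrier (Y m)"
      then obtain d where d: "d \<in> D" "t m (q d) = y"
        using bij qD_onto by (metis (no_types, lifting) bij_betw_imp_surj_on imageE)
      have "g j d = \<zero>\<^bsub>Y j\<^esub>" if "j \<in> I" "m \<prec> j" for j
        using m(2)[OF that(2)] that(1) tq[OF that(1) d(1), symmetric] mod_hom_closed[OF qD, of d] d(1)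
        by auto
      then show "\<exists>x\<in>B. g m x = y \<and> (\<forall>j\<in>I. m \<prec> j \<longrightarrow> g j x = \<zero>\<^bsub>Y j\<^esub>)"
        using d tq[OF mI] DB by auto
    qed
    show ?thesis
      unfolding lead_determined_def
    proof (intro ballI impI)
      fix x i assume x: "x \<in> B" "\<forall>l\<in>lead B. g l x = \<zero>\<^bsub>Y l\<^esub>" and i: "i \<in> I"
      have xD: "x \<in> D" using x lead_mono[OF AB] by (auto simp: D_def)
      \<comment> \<open>The new pivot forces this zero, and injectivity of \<open>t m\<close> then
        gives \<open>q x = 0\<close>, which reduces to the kernel case.\<close>
      have "t m (q x) = \<zero>\<^bsub>Y m\<^esub>" using tq[OF mI xD] x lead by simp
      then have "t m (q x) = t m \<zero>\<^bsub>X\<^esub>" using mod_hom_zero[OF lmX Y[OF mI] t[OF mI]] by simp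
      moreover have "q x \<in> carrier X" "\<zero>\<^bsub>X\<^esub> \<in> carrier X"
        using xD qD_onto abelian_monoid.zero_closed[OF abelian_group.axioms(1)]
          left_module_abelian_group[OF lmX] by blast+
      ultimately have "q x = \<zero>\<^bsub>X\<^esub>" using bij by (metis bij_betw_imp_inj_on inj_onD)
      then show "g i x = \<zero>\<^bsub>Y i\<^esub>" using kerD xD i by blast
    qed
  qed
qed

text \<open>Transfinite induction along the filtration: the zero term is trivial, and the extension
  lemma handles successors.\<close>

lemma lead_determined_filtration:
  assumes sb: "semibrick R \<X>" and YX: "\<And>i. i \<in> I \<Longrightarrow> Y i \<in> \<X>"
    and F: "X_filtration R \<X> N F \<mu>"
  shows "lead_determined (carrier N)"
proof -
  have sub: "\<And>\<alpha>. \<alpha> \<le> \<mu> \<Longrightarrow> submodule (F \<alpha>) R N"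
    and mono: "\<And>\<alpha> \<beta>. \<lbrakk>\<alpha> \<le> \<mu>; \<beta> \<le> \<alpha>\<rbrakk> \<Longrightarrow> F \<beta> \<subseteq> F \<alpha>"
    and zero: "F ord_zero = {\<zero>\<^bsub>N\<^esub>}" and top: "F \<mu> = carrier N"
    and lim: "\<And>\<nu>. \<lbrakk>\<nu> \<le> \<mu>; ord_limit \<nu>\<rbrakk> \<Longrightarrow> F \<nu> = (\<Union>\<alpha>\<in>{..<\<nu>}. F \<alpha>)"
    and fac: "\<And>\<alpha>. \<alpha> < \<mu> \<Longrightarrow>
      \<exists>X\<in>\<X>. mod_iso R (quotient_module (N\<lparr>carrier := F (ord_succ \<alpha>)\<rparr>) (F \<alpha>)) X"
    using F unfolding X_filtration_def filtration_def by blast+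
  have "lead_determined (F \<alpha>)" if "\<alpha> \<le> \<mu>" for \<alpha>
    using that
  proof (induction \<alpha> rule: less_induct)
    case (less \<alpha>)
    consider "\<alpha> = ord_zero" | \<beta> where "\<beta> < \<alpha>" "\<alpha> = ord_succ \<beta>" | "ord_limit \<alpha>"
      by (auto simp: ord_limit_def)
    then show ?case
    proof cases
      case 1
      then show ?thesis
        using zero mod_hom_zero[OF left_module_axioms Y g] by (simp add: lead_determined_def)
    next
      case 2
      then obtain X where X: "X \<in> \<X>"
        "mod_iso R (quotient_module (N\<lparr>carrier := F \<alpha>\<rparr>) (F \<beta>)) X"
        using fac[of \<beta>] less.prems order.strict_trans2 by blast
      have \<beta>: "\<beta> \<le> \<mu>" "\<beta> \<le> \<alpha>" using 2 less.prems by auto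
      show ?thesis
        by (rule lead_determined_extension[OF sb YX X(1) sub[OF \<beta>(1)] sub[OF less.prems]
              mono[OF less.prems \<beta>(2)] X(2) less.IH[OF 2(1) \<beta>(1)]])
    next
      case 3
      show ?thesis
        unfolding lead_determined_def
      proof (intro ballI impI)
        fix x i assume x: "x \<in> F \<alpha>" "\<forall>l\<in>lead (F \<alpha>). g l x = \<zero>\<^bsub>Y l\<^esub>" and i: "i \<in> I"
        \<comment> \<open>At a limit each element already lies in an earlier term. Its pivots
          persist in the union, so the earlier invariant suffices.\<close>
        obtain \<beta> where \<beta>: "\<beta> < \<alpha>" "x \<in> F \<beta>" using x(1) lim[OF less.prems 3] by auto
        have "lead (F \<beta>) \<subseteq> lead (F \<alpha>)" using lead_mono mono less.prems \<beta>(1) by simp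
        moreover have "lead_determined (F \<beta>)" using less \<beta> by simp
        ultimately show "g i x = \<zero>\<^bsub>Y i\<^esub>"
          using x \<beta>(2) i unfolding lead_determined_def by blast
      qed
    qed
  qed
  then show ?thesis using top by (metis order_refl)
qed

end

section \<open>A well-order on the indices and the splitting of \<open>M\<close>\<close>

text \<open>The well-ordering theorem, with the diagonal removed to obtain a strict
  relation.\<close>

lemma ex_strict_wellorder:
  "\<exists>less :: 'a \<Rightarrow> 'a \<Rightarrow> bool. wfp less \<and> transp less \<and> totalp less"
proof -
  obtain r :: "'a rel" where r: "Well_order r" "Field r = UNIV"
    using well_ordering[where 'a = 'a] by (elim exE conjE)
  let ?less = "\<lambda>x y. (x, y) \<in> r - Id"
  have "wf (r - Id)" using r by (simp add: well_order_on_def)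
  then have "wfp ?less" by (rule wfp_wf_eq[THEN iffD2])
  moreover have "transp ?less"
  proof (rule transpI)
    fix x y z assume xyz: "(x, y) \<in> r - Id" "(y, z) \<in> r - Id"
    have "Relation.trans r" "antisym r" using r by (simp_all add: order_on_defs)
    then show "(x, z) \<in> r - Id"
      using xyz by (metis DiffD1 DiffD2 DiffI antisymD pair_in_Id_conv transD)
  qed
  moreover have "totalp ?less"
    using r by (simp add: order_on_defs total_on_def totalp_on_def)
  ultimately show ?thesis by (intro exI[of _ ?less] conjI)
qed

theorem proposition3p5:
  fixes R :: "('a, 'r) ring_scheme"
    and \<X> :: "('a, 'b) module set"
    and N :: "('a, 'c) module"
    and M :: "('a, 'd) module"
    and F :: "'i::wellorder \<Rightarrow> 'c set" and \<mu> :: 'i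
    and f :: "'c \<Rightarrow> 'd"
  assumes "ring R"
    and "semibrick R \<X>"
    and "left_module R N" and "X_filtration R \<X> N F \<mu>"
    and "left_module R M" and "X_semisimple R \<X> M"
    and "f \<in> mod_hom R N M"
  shows "submodule (f ` carrier N) R M
    \<and> X_semisimple R \<X> (M\<lparr>carrier := f ` carrier N\<rparr>)
    \<and> direct_summand R M (f ` carrier N)"
proof -
  note sb = assms(2) and N = assms(3) and M = assms(5) and f = assms(7)
  interpret N: left_module R N by fact
  interpret M: left_module R M by fact
  obtain I :: "'d set" and Y :: "'d \<Rightarrow> ('a, 'b) module" and \<phi>
    where YX: "\<And>i. i \<in> I \<Longrightarrow> Y i \<in> \<X>"
      and \<phi>: "\<phi> \<in> mod_hom R M (direct_sum I Y)"
      and bij: "bij_betw \<phi> (carrier M) (carrier (direct_sum I Y))"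
    using assms(6) unfolding X_semisimple_def mod_iso_def by blast
  have Y: "left_module R (Y i)" if "i \<in> I" for i
    using sb YX[OF that] by (auto simp: semibrick_def brick_def)
  have comp: "(\<lambda>m. \<phi> m i) \<in> mod_hom R M (Y i)" if "i \<in> I" for i
    using \<phi> that by (auto simp: mod_hom_iff direct_sum_def)
  obtain less :: "'d \<Rightarrow> 'd \<Rightarrow> bool" where less: "wfp less" "transp less" "totalp less"
    using ex_strict_wellorder by blast
  \<comment> \<open>The components are those of \<open>f\<close> followed by the isomorphism
    \<open>\<phi>\<close> onto the direct sum.\<close>
  interpret hom_family R N I Y "\<lambda>i x. \<phi> (f x) i" less
  proof (intro hom_family.intro hom_family_axioms.intro N)
    show "left_module R (Y i)" if "i \<in> I" for i using Y[OF that] .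
    show "(\<lambda>x. \<phi> (f x) i) \<in> mod_hom R N (Y i)" if "i \<in> I" for i
      using mod_hom_compose[OF f comp[OF that]] .
    show "finite {i \<in> I. \<phi> (f x) i \<noteq> \<zero>\<^bsub>Y i\<^esub>}" if "x \<in> carrier N" for x
      using mod_hom_closed[OF \<phi> mod_hom_closed[OF f that]] by (simp add: direct_sum_def)
  qed (use less in auto)
  define L where "L = lead (carrier N)"
  define H where "H = f ` carrier N"
  \<comment> \<open>Under \<open>\<phi>\<close> this is the part of the direct sum supported outside
    the pivots.\<close>
  define C where "C = {m \<in> carrier M. \<forall>l\<in>L. \<phi> m l = \<zero>\<^bsub>Y l\<^esub>}"
  have LI: "L \<subseteq> I" by (simp add: L_def lead_subset)
  have H: "submodule H R M" unfolding H_def by (rule mod_hom_image_submodule[OF N M f])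
  have HM: "H \<subseteq> carrier M" by (rule submodule_subset[OF H])
  have NN: "submodule (carrier N) R N" by (rule N.left_submoduleI) auto
  have MM: "submodule (carrier M) R M" by (rule M.left_submoduleI) auto
  have C: "submodule C R M"
    unfolding C_def using LI Y comp by (intro M.submodule_common_kernel[OF MM]) auto
  have lift: "\<exists>h\<in>H. \<forall>l\<in>L. \<phi> h l = y l" if "y \<in> carrier (direct_sum I Y)" for y
    by (rule lead_interpolation[OF NN that]) (auto simp: H_def L_def)
  \<comment> \<open>For an element of the image, the invariant for all of \<open>N\<close> makes
    every component vanish, and \<open>\<phi>\<close> is injective.\<close>
  have inj: "h = \<zero>\<^bsub>M\<^esub>" if h: "h \<in> H" "\<And>l. l \<in> L \<Longrightarrow> \<phi> h l = \<zero>\<^bsub>Y l\<^esub>" for h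
  proof -
    have hM: "h \<in> carrier M" using h HM by auto
    have "\<phi> h i = \<phi> \<zero>\<^bsub>M\<^esub> i" if i: "i \<in> I" for i
      using lead_determined_filtration[OF sb YX assms(4)] h i mod_hom_zero[OF M Y[OF i] comp[OF i]]
      unfolding lead_determined_def H_def L_def by auto
    then have "\<phi> h = \<phi> \<zero>\<^bsub>M\<^esub>"
      using mod_hom_closed[OF \<phi> hM] mod_hom_closed[OF \<phi> M.zero_closed]
      by (auto simp: direct_sum_def intro: PiE_ext)
    then show ?thesis using bij hM M.zero_closed by (metis bij_betw_imp_inj_on inj_onD)
  qed
  have comp_minus: "\<phi> (x \<ominus>\<^bsub>M\<^esub> y) i = \<zero>\<^bsub>Y i\<^esub>"
    if "x \<in> carrier M" "y \<in> carrier M" "i \<in> I" "\<phi> x i = \<phi> y i" for x y i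
  proof -
    interpret Yi: left_module R "Y i" using Y[OF that(3)] .
    show ?thesis
      using mod_hom_minus[OF M Y comp, OF that(3,3) that(1,2)] that(4)
        mod_hom_closed[OF comp[OF that(3)] that(2)]
      by (simp add: Yi.minus_self)
  qed
  have "H <+>\<^bsub>M\<^esub> C = carrier M"
  proof
    show "H <+>\<^bsub>M\<^esub> C \<subseteq> carrier M"
      using HM by (auto simp: set_add_def' C_def)
    show "carrier M \<subseteq> H <+>\<^bsub>M\<^esub> C"
    proof
      fix m assume m: "m \<in> carrier M"
      \<comment> \<open>Interpolation finds the image part of \<open>m\<close>: once the pivot
        components agree, the remainder lies in \<open>C\<close>.\<close>
      obtain h where h: "h \<in> H" "\<And>l. l \<in> L \<Longrightarrow> \<phi> h l = \<phi> m l"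
        using lift[OF mod_hom_closed[OF \<phi> m]] by blast
      have hM: "h \<in> carrier M" using h HM by auto
      have "m \<ominus>\<^bsub>M\<^esub> h \<in> C"
        using m hM h(2) LI comp_minus[OF m hM] by (auto simp: C_def)
      moreover have "m = h \<oplus>\<^bsub>M\<^esub> (m \<ominus>\<^bsub>M\<^esub> h)"
        using m hM by (simp add: a_minus_def M.a_lcomm[of h] M.r_neg)
      ultimately show "m \<in> H <+>\<^bsub>M\<^esub> C" using h(1) unfolding set_add_def' by blast
    qed
  qed
  moreover have "H \<inter> C = {\<zero>\<^bsub>M\<^esub>}"
  proof
    show "H \<inter> C \<subseteq> {\<zero>\<^bsub>M\<^esub>}" using inj unfolding C_def by blast
    show "{\<zero>\<^bsub>M\<^esub>} \<subseteq> H \<inter> C" using submodule_zero[OF H] submodule_zero[OF C] by simp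
  qed
  ultimately have "direct_summand R M H"
    unfolding direct_summand_def using H C by blast
  moreover have "X_semisimple R \<X> (M\<lparr>carrier := H\<rparr>)"
  proof -
    \<comment> \<open>Projection to the pivot coordinates. On the image it is injective by
      \<open>inj\<close> and surjective by \<open>lift\<close>.\<close>
    define \<psi> where "\<psi> m = (\<lambda>l\<in>L. \<phi> m l)" for m
    have \<psi>_in: "\<psi> m \<in> carrier (direct_sum L Y)" if m: "m \<in> carrier M" for m
    proof -
      have *: "finite {i \<in> I. \<phi> m i \<noteq> \<zero>\<^bsub>Y i\<^esub>}" "\<phi> m \<in> (\<Pi>\<^sub>E i\<in>I. carrier (Y i))"
        using mod_hom_closed[OF \<phi> m] by (auto simp: direct_sum_def)
      have "finite {l \<in> L. \<psi> m l \<noteq> \<zero>\<^bsub>Y l\<^esub>}"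
        by (rule finite_subset[OF _ *(1)]) (use LI in \<open>auto simp: \<psi>_def\<close>)
      then show ?thesis using *(2) LI by (auto simp: direct_sum_def \<psi>_def)
    qed
    have "\<psi> \<in> mod_hom R M (direct_sum L Y)"
      using \<psi>_in comp LI
      by (intro mod_homI) (auto simp: direct_sum_def \<psi>_def mod_hom_iff subset_iff fun_eq_iff)
    then have "\<psi> \<in> mod_hom R (M\<lparr>carrier := H\<rparr>) (direct_sum L Y)"
      using mod_hom_restrict_carrier HM by blast
    moreover have "inj_on \<psi> H"
    proof (rule inj_onI)
      fix x y assume xy: "x \<in> H" "y \<in> H" "\<psi> x = \<psi> y"
      have xyM: "x \<in> carrier M" "y \<in> carrier M" using xy HM by auto
      have "\<phi> x l = \<phi> y l" if "l \<in> L" for l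
        using fun_cong[OF xy(3), of l] that by (simp add: \<psi>_def)
      then have "x \<ominus>\<^bsub>M\<^esub> y = \<zero>\<^bsub>M\<^esub>"
        using LI by (intro inj submodule_minus[OF H xy(1,2)] comp_minus[OF xyM]) auto
      then show "x = y" using xyM M.minus_eq_zeroD by blast
    qed
    moreover have "\<psi> ` H = carrier (direct_sum L Y)"
    proof
      show "\<psi> ` H \<subseteq> carrier (direct_sum L Y)" using \<psi>_in HM by auto
      show "carrier (direct_sum L Y) \<subseteq> \<psi> ` H"
      proof
        fix y assume y: "y \<in> carrier (direct_sum L Y)"
        \<comment> \<open>Extension by zero to all of \<open>I\<close>, since \<open>lift\<close>
          expects an element of the full direct sum.\<close>
        let ?y = "\<lambda>i\<in>I. if i \<in> L then y i else \<zero>\<^bsub>Y i\<^esub>"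
        have z: "\<zero>\<^bsub>Y i\<^esub> \<in> carrier (Y i)" if "i \<in> I" for i
          using abelian_monoid.zero_closed[OF abelian_group.axioms(1)]
            left_module_abelian_group[OF Y[OF that]] by blast
        have *: "finite {l \<in> L. y l \<noteq> \<zero>\<^bsub>Y l\<^esub>}" "y \<in> (\<Pi>\<^sub>E l\<in>L. carrier (Y l))"
          using y by (auto simp: direct_sum_def)
        have "finite {i \<in> I. ?y i \<noteq> \<zero>\<^bsub>Y i\<^esub>}"
          by (rule finite_subset[OF _ *(1)]) (auto split: if_splits)
        moreover have "?y \<in> (\<Pi>\<^sub>E i\<in>I. carrier (Y i))" using *(2) z by auto
        ultimately have "?y \<in> carrier (direct_sum I Y)" by (simp add: direct_sum_def)
        then obtain h where h: "h \<in> H" "\<And>l. l \<in> L \<Longrightarrow> \<phi> h l = ?y l" using lift by blast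
        have "\<psi> h = y"
          using h(2) LI *(2) by (auto simp: \<psi>_def fun_eq_iff PiE_iff extensional_def subset_iff)
        then show "y \<in> \<psi> ` H" using h(1) by auto
      qed
    qed
    ultimately have "mod_iso R (M\<lparr>carrier := H\<rparr>) (direct_sum L Y)"
      unfolding mod_iso_def bij_betw_def by auto
    then show ?thesis unfolding X_semisimple_def using YX LI by blast
  qed
  ultimately show ?thesis using H unfolding H_def by blast
qed

end
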